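(* Let $J\ge 3$. The canonical model $(\text{reference},\text{logistic},\text{complete})$ is invariant under all permutations of $\{1,\dots,J\}$.
   Context: Setting. Let $J\ge 3$ (number of categories), $p\ge 1$, and let $\mathcal{X}\subseteq\mathbb{R}^p$ be the nonempty set of values of the explanatory vector $x$. Let $\mathcal{M}=\{\pi\in\,]0,1[^{J-1} : \sum_{j=1}^{J-1}\pi_j<1\}$; for $\pi\in\mathcal{M}$ put $\pi_J=1-\sum_{j=1}^{J-1}\pi_j$ ($\pi_j$ is the probability of category $j$). Ratio. The reference ratio $r:\mathcal{M}\to\,]0,1[^{J-1}$ is $r_j(\pi)=\pi_j/(\pi_j+\pi_J)$, $j=1,\dots,J-1$; it is a bijection onto $]0,1[^{J-1}$. Cdf. The logistic cdf is $F(w)=e^w/(1+e^w)$, $w\in\mathbb{R}$. Design matrix. "Complete" refers to the $(J-1)\times(J-1)(1+p)$ matrix $Z_c(x)$ with $Z_c(x)\beta=(\alpha_j+x^t\delta_j)_{j=1,\dots,J-1}$ for $\beta=(\alpha_1,\dots,\alpha_{J-1},\delta_1^t,\dots,\delta_{J-1}^t)^t$, $\alpha_j\in\mathbb{R}$, $\delta_j\in\mathbb{R}^p$. Models. The model $(\text{reference},\text{logistic},\text{complete})$ has parameter space $\mathbb{R}^{(J-1)(1+p)}$. For $\beta$ in it and $x\in\mathcal{X}$, it defines the unique $\pi=\pi(x;\beta)\in\mathcal{M}$ with $r(\pi)=(F(\eta_1),\dots,F(\eta_{J-1}))^t$, where $\eta=Z_c(x)\beta$. Permuted models. For a permutation $\sigma$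 of $\{1,\dots,J\}$ and $\pi\in\mathcal{M}$, let $\pi_\sigma=(\pi_{\sigma(1)},\dots,\pi_{\sigma(J-1)})\in\mathcal{M}$. The permuted model, indexed by $\sigma$, has the same parameter space and defines $\pi=\pi(x;\beta)\in\mathcal{M}$ by $r(\pi_\sigma)=(F(\eta_1),\dots,F(\eta_{J-1}))^t$, $\eta=Z_c(x)\beta$. Equivalence and invariance. Two (possibly permuted) models, giving $\pi(x;\beta)$ and $\pi'(x;\beta')$, are equivalent if there is a bijection $h$ from the parameter space of the first to that of the second such that $\pi(x;\beta)=\pi'(x;h(\beta))$ for all $x\in\mathcal{X}$ and all $\beta$ in the first parameter space. A model is invariant under $\sigma$ if it is equivalent to its permuted model indexed by $\sigma$. *)

theory Defs
  imports Complex_Main "HOL-Combinatorics.Permutations" "Jordan_Normal_Form.Matrix"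
begin

(* Categories are numbered 1, ..., J as usual, while entries of a vec are numbered from 0:
   category j with j < J is stored at entry j - 1, and category J is the reference one. *)

definition prob_vecs :: "nat \<Rightarrow> real vec set" where
  "prob_vecs J = {\<pi> \<in> carrier_vec (J - 1).
     (\<forall>i<J - 1. 0 < \<pi> $ i \<and> \<pi> $ i < 1) \<and> (\<Sum>i<J - 1. \<pi> $ i) < 1}"

definition cat_prob :: "nat \<Rightarrow> real vec \<Rightarrow> nat \<Rightarrow> real" where
  "cat_prob J \<pi> j = (if j = J then 1 - (\<Sum>i<J - 1. \<pi> $ i) else \<pi> $ (j - 1))"

definition reference_ratio :: "nat \<Rightarrow> real vec \<Rightarrow> real vec" where
  "reference_ratio J \<pi> =
     vec (J - 1) (\<lambda>i. cat_prob J \<pi> (i + 1) / (cat_prob J \<pi> (i + 1) + cat_prob J \<pi> J))"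

definition logistic_cdf :: "real \<Rightarrow> real" where
  "logistic_cdf w = exp w / (1 + exp w)"

(* The columns follow the order alpha_1, ..., alpha_(J-1), delta_1, ..., delta_(J-1)
   of the parameters, where every delta_j takes up p columns. *)

definition complete_design :: "nat \<Rightarrow> nat \<Rightarrow> real vec \<Rightarrow> real mat" where
  "complete_design J p x = mat (J - 1) ((J - 1) * (1 + p)) (\<lambda>(i, c).
     if c = i then 1
     else if (J - 1) + i * p \<le> c \<and> c < (J - 1) + (i + 1) * p
       then x $ (c - ((J - 1) + i * p))
     else 0)"

lemma complete_design_mult_vec:
  assumes "i < J - 1" "x \<in> carrier_vec p" "\<beta> \<in> carrier_vec ((J - 1) * (1 + p))"
  shows "(complete_design J p x *\<^sub>v \<beta>) $ i
    = \<beta> $ i + x \<bullet> vec p (\<lambda>k. \<beta> $ ((J - 1) + i * p + k))"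
proof -
  define n where "n = J - 1"
  define s where "s = n + i * p"
  define N where "N = n * (1 + p)"
  have i: "i < n" using assms n_def by simp
  have "(i + 1) * p \<le> n * p" using i by (intro mult_right_mono) auto
  then have sN: "s + p \<le> N" by (simp add: s_def N_def algebra_simps)
  have i_less_s: "i < s" using i by (simp add: s_def)
  have "(complete_design J p x *\<^sub>v \<beta>) $ i =
    (\<Sum>c\<in>{0..<N}. (if c = i then 1 else if s \<le> c \<and> c < s + p then x $ (c - s) else 0) * \<beta> $ c)"
    using assms i unfolding complete_design_def n_def[symmetric] N_def[symmetric]
    by (auto simp: scalar_prod_def s_def N_def algebra_simps intro!: sum.cong)
  also have "\<dots> = (\<Sum>c\<in>{0..<N}. (if c = i then \<beta> $ c else 0)
      + (if c \<in> {s..<s + p} then x $ (c - s) * \<beta> $ c else 0))"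
    using i_less_s by (intro sum.cong) auto
  also have "\<dots> = \<beta> $ i
      + (\<Sum>c\<in>{0..<N}. if c \<in> {s..<s + p} then x $ (c - s) * \<beta> $ c else 0)"
    using i_less_s sN by (simp add: sum.distrib)
  also have "(\<Sum>c\<in>{0..<N}. if c \<in> {s..<s + p} then x $ (c - s) * \<beta> $ c else 0)
      = (\<Sum>c\<in>{0 + s..<p + s}. x $ (c - s) * \<beta> $ c)"
    using sN by (intro sum.mono_neutral_cong_right) auto
  also have "(\<Sum>c\<in>{0 + s..<p + s}. x $ (c - s) * \<beta> $ c) = (\<Sum>k\<in>{0..<p}. x $ k * \<beta> $ (s + k))"
    by (subst sum.shift_bounds_nat_ivl) (simp add: add.commute)
  finally show ?thesis
    by (simp add: scalar_prod_def s_def n_def)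
qed

definition permute_probs :: "nat \<Rightarrow> (nat \<Rightarrow> nat) \<Rightarrow> real vec \<Rightarrow> real vec" where
  "permute_probs J \<sigma> \<pi> = vec (J - 1) (\<lambda>i. cat_prob J \<pi> (\<sigma> (i + 1)))"

(* The model (r, F, Z), as the map sending x and the parameter to the probabilities.
   The description is meaningful whenever r is a bijection from prob_vecs J onto the vectors
   with entries in ]0, 1[ and F takes its values in ]0, 1[, as is the case for
   reference_ratio J and logistic_cdf. *)

definition model_prob ::
  "nat \<Rightarrow> (real vec \<Rightarrow> real vec) \<Rightarrow> (real \<Rightarrow> real) \<Rightarrow> (real vec \<Rightarrow> real mat)
     \<Rightarrow> real vec \<Rightarrow> real vec \<Rightarrow> real vec" where
  "model_prob J r F Z x \<beta> =
     (THE \<pi>. \<pi> \<in> prob_vecs J \<and> r \<pi> = map_vec F (Z x *\<^sub>v \<beta>))"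

definition permuted_model_prob ::
  "nat \<Rightarrow> (nat \<Rightarrow> nat) \<Rightarrow> (real vec \<Rightarrow> real vec) \<Rightarrow> (real \<Rightarrow> real) \<Rightarrow> (real vec \<Rightarrow> real mat)
     \<Rightarrow> real vec \<Rightarrow> real vec \<Rightarrow> real vec" where
  "permuted_model_prob J \<sigma> r F Z x \<beta> =
     (THE \<pi>. \<pi> \<in> prob_vecs J \<and> r (permute_probs J \<sigma> \<pi>) = map_vec F (Z x *\<^sub>v \<beta>))"

definition equivalent_models ::
  "'x set \<Rightarrow> 'b set \<Rightarrow> ('x \<Rightarrow> 'b \<Rightarrow> 'c) \<Rightarrow> 'd set \<Rightarrow> ('x \<Rightarrow> 'd \<Rightarrow> 'c) \<Rightarrow> bool" where
  "equivalent_models X B P B' P' \<longleftrightarrow>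
     (\<exists>h. bij_betw h B B' \<and> (\<forall>x\<in>X. \<forall>\<beta>\<in>B. P x \<beta> = P' x (h \<beta>)))"

(* B is the parameter space of the model (r, F, Z). *)

definition invariant_under ::
  "nat \<Rightarrow> real vec set \<Rightarrow> real vec set \<Rightarrow> (real vec \<Rightarrow> real vec) \<Rightarrow> (real \<Rightarrow> real)
     \<Rightarrow> (real vec \<Rightarrow> real mat) \<Rightarrow> (nat \<Rightarrow> nat) \<Rightarrow> bool" where
  "invariant_under J X B r F Z \<sigma> \<longleftrightarrow>
     equivalent_models X B (model_prob J r F Z) B (permuted_model_prob J \<sigma> r F Z)"

end

theory Submission
  imports Defs
begin

text \<open>
  The model says that \<open>ln (\<pi>\<^sub>j / \<pi>\<^sub>J)\<close> is the linear predictor of category \<open>j\<close>, with the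
  convention that category \<open>J\<close> has all coefficients zero. Permuting the categories by \<open>\<sigma>\<close> replaces
  this log-odds by \<open>ln (\<pi>\<^sub>\<sigma>\<^sub>j / \<pi>\<^sub>\<sigma>\<^sub>J)\<close>, the difference of the predictors of \<open>\<sigma> j\<close> and \<open>\<sigma> J\<close>.
  In the complete design every category has its own coefficients, so the corresponding change of
  parameter is to permute the coefficients and subtract those of \<open>\<sigma> J\<close>; the inverse
  permutation undoes it.
\<close>

text \<open>Clearing denominators, the terms \<open>a * exp w\<close> cancel and
  \<open>a = b * exp w\<close> remains: the ratio fixes exactly the odds
  \<open>a / b\<close>.\<close>

lemma logistic_cdf_eq_iff:
  fixes a b w :: real
  assumes "0 < a" "0 < b"
  shows "a / (a + b) = logistic_cdf w \<longleftrightarrow> ln a - ln b = w"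
proof -
  have e: "0 < 1 + exp w" by (simp add: add_pos_pos)
  have "a / (a + b) = logistic_cdf w \<longleftrightarrow> a = b * exp w"
    using assms e by (simp add: logistic_cdf_def frac_eq_eq algebra_simps)
  also have "\<dots> \<longleftrightarrow> ln a = ln (b * exp w)"
    using assms by (subst ln_inj_iff) auto
  also have "\<dots> \<longleftrightarrow> ln a - ln b = w"
    using assms by (auto simp: ln_mult)
  finally show ?thesis .
qed

lemma sum_cat_prob:
  assumes "1 \<le> J"
  shows "(\<Sum>j\<in>{1..J}. cat_prob J \<pi> j) = 1"
proof -
  have "(\<Sum>j\<in>{1..J}. cat_prob J \<pi> j) = (\<Sum>i<J. cat_prob J \<pi> (Suc i))"
    using sum.shift_bounds_cl_Suc_ivl[of "cat_prob J \<pi>" 0 "J - 1"] assms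
    by (simp add: atLeast0AtMost lessThan_Suc_atMost[symmetric])
  also have "\<dots> = (\<Sum>i<J - 1. cat_prob J \<pi> (Suc i)) + cat_prob J \<pi> J"
    using sum.lessThan_Suc[of "\<lambda>i. cat_prob J \<pi> (Suc i)" "J - 1"] assms by simp
  also have "(\<Sum>i<J - 1. cat_prob J \<pi> (Suc i)) = (\<Sum>i<J - 1. \<pi> $ i)"
    by (intro sum.cong) (auto simp: cat_prob_def)
  finally show ?thesis by (simp add: cat_prob_def)
qed

lemma cat_prob_pos:
  assumes "\<pi> \<in> prob_vecs J" "j \<in> {1..J}"
  shows "0 < cat_prob J \<pi> j"
  using assms by (auto simp: prob_vecs_def cat_prob_def)

text \<open>Only \<open>j = J\<close> needs an argument, since that value is not stored but
  recovered as a complement. Both families sum to 1, because permuting the summands keeps the total,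
  and they agree off \<open>J\<close>; hence they agree at \<open>J\<close> too.\<close>

lemma cat_prob_permute_probs:
  assumes "\<sigma> permutes {1..J}" "j \<in> {1..J}"
  shows "cat_prob J (permute_probs J \<sigma> \<pi>) j = cat_prob J \<pi> (\<sigma> j)"
proof -
  define \<rho> where "\<rho> = permute_probs J \<sigma> \<pi>"
  have J: "1 \<le> J" using assms by simp
  have eq: "cat_prob J \<rho> i = cat_prob J \<pi> (\<sigma> i)" if "i \<in> {1..J} - {J}" for i
  proof -
    have "cat_prob J \<rho> i = \<rho> $ (i - 1)" using that by (simp add: cat_prob_def)
    also have "\<dots> = cat_prob J \<pi> (\<sigma> i)" using that by (auto simp: \<rho>_def permute_probs_def)
    finally show ?thesis .
  qed
  have "(\<Sum>i\<in>{1..J}. cat_prob J \<rho> i) = (\<Sum>i\<in>{1..J}. cat_prob J \<pi> (\<sigma> i))"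
    using sum.permute[OF assms(1), of "cat_prob J \<pi>"] J by (simp add: sum_cat_prob del: One_nat_def)
  then have "cat_prob J \<rho> J + (\<Sum>i\<in>{1..J} - {J}. cat_prob J \<rho> i)
      = cat_prob J \<pi> (\<sigma> J) + (\<Sum>i\<in>{1..J} - {J}. cat_prob J \<pi> (\<sigma> i))"
    using J by (subst (asm) (1 2) sum.remove[of _ J]) auto
  moreover have "(\<Sum>i\<in>{1..J} - {J}. cat_prob J \<rho> i) = (\<Sum>i\<in>{1..J} - {J}. cat_prob J \<pi> (\<sigma> i))"
    using eq by (intro sum.cong) auto
  ultimately have "cat_prob J \<rho> J = cat_prob J \<pi> (\<sigma> J)" by simp
  then show ?thesis using eq[of j] assms(2) unfolding \<rho>_def by (cases "j = J") auto
qed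

text \<open>Coefficient 0 of a category is the intercept, coefficient \<open>k + 1\<close> multiplies \<open>x $ k\<close>.\<close>

definition coef :: "nat \<Rightarrow> nat \<Rightarrow> real vec \<Rightarrow> nat \<Rightarrow> nat \<Rightarrow> real" where
  "coef J p \<beta> j k =
     (if j = J then 0 else if k = 0 then \<beta> $ (j - 1) else \<beta> $ ((J - 1) + (j - 1) * p + (k - 1)))"

text \<open>Decodes the storage order: past the intercepts come blocks of length \<open>p\<close>,
  so quotient and remainder by \<open>p\<close> give the category and the coordinate of
  \<open>x\<close>.\<close>

definition param_of_coefs :: "nat \<Rightarrow> nat \<Rightarrow> (nat \<Rightarrow> nat \<Rightarrow> real) \<Rightarrow> real vec" where
  "param_of_coefs J p f = vec ((J - 1) * (1 + p)) (\<lambda>c.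
     if c < J - 1 then f (c + 1) 0
     else f ((c - (J - 1)) div p + 1) ((c - (J - 1)) mod p + 1))"

definition permute_param :: "nat \<Rightarrow> nat \<Rightarrow> (nat \<Rightarrow> nat) \<Rightarrow> real vec \<Rightarrow> real vec" where
  "permute_param J p \<sigma> \<beta> =
     param_of_coefs J p (\<lambda>j k. coef J p \<beta> (\<sigma> j) k - coef J p \<beta> (\<sigma> J) k)"

text \<open>Extends the entries of the design product to category \<open>J\<close>, with value 0, so
  that a permutation can act on all categories alike.\<close>

definition linear_predictor :: "nat \<Rightarrow> nat \<Rightarrow> real vec \<Rightarrow> real vec \<Rightarrow> nat \<Rightarrow> real" where
  "linear_predictor J p x \<beta> j = coef J p \<beta> j 0 + (\<Sum>k<p. x $ k * coef J p \<beta> j (Suc k))"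

lemma param_of_coefs_carrier: "param_of_coefs J p f \<in> carrier_vec ((J - 1) * (1 + p))"
  by (simp add: param_of_coefs_def)

lemma coef_param_of_coefs:
  assumes "j \<in> {1..<J}" "k \<le> p"
  shows "coef J p (param_of_coefs J p f) j k = f j k"
proof (cases k)
  case 0
  then show ?thesis using assms
    by (auto simp: coef_def param_of_coefs_def trans_less_add1)
next
  case (Suc l)
  \<comment> \<open>Since \<open>l < p\<close>, the entry lies in the block of category
    \<open>j\<close>, hence inside the vector.\<close>
  have "(j - 1) * p + l < (J - 1) * p"
  proof -
    have "(j - 1) * p + l < (j - 1) * p + p" using assms Suc by simp
    also have "\<dots> = (j - 1 + 1) * p" by (simp add: algebra_simps)
    also have "\<dots> \<le> (J - 1) * p" using assms by (intro mult_right_mono) auto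
    finally show ?thesis .
  qed
  moreover have "((j - 1) * p + l) div p = j - 1" "((j - 1) * p + l) mod p = l"
    using assms Suc by (auto simp: div_mult_self3)
  ultimately show ?thesis using assms Suc
    by (auto simp: coef_def param_of_coefs_def add.assoc)
qed

lemma param_of_coefs_coef:
  assumes "\<beta> \<in> carrier_vec ((J - 1) * (1 + p))" "\<And>j k. j \<in> {1..<J} \<Longrightarrow> k \<le> p \<Longrightarrow> f j k = coef J p \<beta> j k"
  shows "param_of_coefs J p f = \<beta>"
proof (rule eq_vecI)
  show "dim_vec (param_of_coefs J p f) = dim_vec \<beta>"
    using assms by (simp add: param_of_coefs_def)
next
  fix c assume "c < dim_vec \<beta>"
  then have c: "c < (J - 1) * (1 + p)" using assms by simp
  show "param_of_coefs J p f $ c = \<beta> $ c"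
  proof (cases "c < J - 1")
    case True
    then show ?thesis using c assms(2)[of "c + 1" 0] by (simp add: param_of_coefs_def coef_def)
  next
    case False
    define d where "d = c - (J - 1)"
    have d: "d < (J - 1) * p" "c = J - 1 + d" using c False by (auto simp: d_def algebra_simps)
    \<comment> \<open>An entry past the intercepts exists, so \<open>p\<close> is positive and
      division by \<open>p\<close> decodes its position.\<close>
    then have p: "0 < p" by (cases p) auto
    have "d div p < J - 1" using d p by (simp add: div_less_iff_less_mult)
    moreover have "Suc (d mod p) \<le> p" using p by (simp add: Suc_leI)
    ultimately show ?thesis using c False assms(2)[of "d div p + 1" "d mod p + 1"] d
      by (simp add: param_of_coefs_def coef_def add.assoc)
  qed
qed

text \<open>At \<open>j = J\<close> both sides vanish: subtracting the coefficients of
  \<open>\<sigma> J\<close> is what restores the zero convention for the reference category.\<close>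

lemma coef_permute_param:
  assumes "j \<in> {1..J}" "k \<le> p"
  shows "coef J p (permute_param J p \<sigma> \<beta>) j k = coef J p \<beta> (\<sigma> j) k - coef J p \<beta> (\<sigma> J) k"
proof (cases "j = J")
  case True
  then show ?thesis by (simp add: coef_def)
next
  case False
  then show ?thesis using assms unfolding permute_param_def by (subst coef_param_of_coefs) auto
qed

text \<open>At \<open>\<tau> j\<close> and at \<open>\<tau> J\<close> the inner map subtracts the
  same coefficients, those of \<open>\<sigma> J\<close>. The outer difference cancels them and
  leaves the coefficients of \<open>j\<close> minus those of \<open>J\<close>, which are zero. The
  one-sided identity serves for both orders of composition.\<close>

lemma permute_param_inverse:
  assumes "\<tau> permutes {1..J}" "\<And>j. \<sigma> (\<tau> j) = j" "1 \<le> J"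
    and "\<beta> \<in> carrier_vec ((J - 1) * (1 + p))"
  shows "permute_param J p \<tau> (permute_param J p \<sigma> \<beta>) = \<beta>"
  unfolding permute_param_def[of J p \<tau>]
proof (rule param_of_coefs_coef[OF assms(4)])
  fix j k assume "j \<in> {1..<J}" "k \<le> p"
  moreover have "\<tau> i \<in> {1..J}" if "i \<in> {1..J}" for i
    using permutes_in_image[OF assms(1)] that by blast
  ultimately show "coef J p (permute_param J p \<sigma> \<beta>) (\<tau> j) k
      - coef J p (permute_param J p \<sigma> \<beta>) (\<tau> J) k = coef J p \<beta> j k"
    using assms(2,3) by (simp add: coef_permute_param coef_def[of J p \<beta> J])
qed

lemma bij_betw_permute_param:
  assumes "\<sigma> permutes {1..J}" "1 \<le> J"
  shows "bij_betw (permute_param J p \<sigma>)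
    (carrier_vec ((J - 1) * (1 + p))) (carrier_vec ((J - 1) * (1 + p)))"
proof (rule bij_betw_byWitness[where f' = "permute_param J p (inv_into UNIV \<sigma>)"])
  show "\<forall>\<beta>\<in>carrier_vec ((J - 1) * (1 + p)).
      permute_param J p (inv_into UNIV \<sigma>) (permute_param J p \<sigma> \<beta>) = \<beta>"
    using permute_param_inverse[OF permutes_inv[OF assms(1)]] permutes_inverses(1)[OF assms(1)] assms(2)
    by blast
  show "\<forall>\<beta>\<in>carrier_vec ((J - 1) * (1 + p)).
      permute_param J p \<sigma> (permute_param J p (inv_into UNIV \<sigma>) \<beta>) = \<beta>"
    using permute_param_inverse[OF assms(1)] permutes_inverses(2)[OF assms(1)] assms(2)
    by blast
qed (auto simp: permute_param_def intro: param_of_coefs_carrier[simplified])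

lemma linear_predictor_reference [simp]: "linear_predictor J p x \<beta> J = 0"
  by (simp add: linear_predictor_def coef_def)

lemma linear_predictor_permute_param:
  assumes "j \<in> {1..J}"
  shows "linear_predictor J p x (permute_param J p \<sigma> \<beta>) j
    = linear_predictor J p x \<beta> (\<sigma> j) - linear_predictor J p x \<beta> (\<sigma> J)"
proof -
  have "(\<Sum>k<p. x $ k * coef J p (permute_param J p \<sigma> \<beta>) j (Suc k))
      = (\<Sum>k<p. x $ k * coef J p \<beta> (\<sigma> j) (Suc k) - x $ k * coef J p \<beta> (\<sigma> J) (Suc k))"
    using assms by (intro sum.cong) (auto simp: coef_permute_param algebra_simps)
  then show ?thesis
    using assms by (simp add: linear_predictor_def coef_permute_param sum_subtractf)
qed

lemma complete_design_mult_vec_eq_linear_predictor: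
  assumes "i < J - 1" "x \<in> carrier_vec p" "\<beta> \<in> carrier_vec ((J - 1) * (1 + p))"
  shows "(complete_design J p x *\<^sub>v \<beta>) $ i = linear_predictor J p x \<beta> (i + 1)"
  using assms
  by (simp add: complete_design_mult_vec linear_predictor_def coef_def scalar_prod_def
      atLeast0LessThan del: index_mult_mat_vec)

text \<open>Coordinatewise this is \<open>logistic_cdf_eq_iff\<close>. The instance
  \<open>j = J\<close> reads 0 = 0; including it makes the quantifier range over the set that
  \<open>\<sigma>\<close> permutes. Positivity of the category probabilities is the form of
  hypothesis that applies to permuted vectors as well.\<close>

lemma reference_ratio_eq_iff:
  assumes pos: "\<And>j. j \<in> {1..J} \<Longrightarrow> 0 < cat_prob J \<rho> j" and "1 \<le> J"
    and "x \<in> carrier_vec p" "\<beta> \<in> carrier_vec ((J - 1) * (1 + p))"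
  shows "reference_ratio J \<rho> = map_vec logistic_cdf (complete_design J p x *\<^sub>v \<beta>) \<longleftrightarrow>
    (\<forall>j\<in>{1..J}. ln (cat_prob J \<rho> j) - ln (cat_prob J \<rho> J) = linear_predictor J p x \<beta> j)"
    (is "?L \<longleftrightarrow> (\<forall>j\<in>{1..J}. ?P j)")
proof -
  have dim: "dim_vec (complete_design J p x *\<^sub>v \<beta>) = J - 1"
    by (simp add: complete_design_def)
  have "?L \<longleftrightarrow> (\<forall>i<J - 1. cat_prob J \<rho> (i + 1) / (cat_prob J \<rho> (i + 1) + cat_prob J \<rho> J)
      = logistic_cdf (linear_predictor J p x \<beta> (i + 1)))"
    using dim assms(3,4)
    by (auto simp: vec_eq_iff reference_ratio_def complete_design_mult_vec_eq_linear_predictor[simplified]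
        simp del: index_mult_mat_vec)
  also have "\<dots> \<longleftrightarrow> (\<forall>i<J - 1. ?P (i + 1))"
    using assms by (simp add: logistic_cdf_eq_iff)
  also have "\<dots> \<longleftrightarrow> (\<forall>j\<in>{1..J}. ?P j)"
  proof (intro iffI ballI)
    fix j assume *: "\<forall>i<J - 1. ?P (i + 1)" "j \<in> {1..J}"
    show "?P j"
    proof (cases "j = J")
      case False
      then show ?thesis using * by (auto dest: spec[of _ "j - 1"])
    qed simp
  qed auto
  finally show ?thesis .
qed

text \<open>Both sides say that \<open>u - v\<close> is constant on \<open>A\<close>, a property
  that depends neither on the base point nor on the labelling of \<open>A\<close>.\<close>

lemma permutes_differences_eq_iff:
  fixes u v :: "'a \<Rightarrow> 'b::ab_group_add"
  assumes "\<sigma> permutes A" "a \<in> A"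
  shows "(\<forall>j\<in>A. u (\<sigma> j) - u (\<sigma> a) = v (\<sigma> j) - v (\<sigma> a)) \<longleftrightarrow>
    (\<forall>j\<in>A. u j - u a = v j - v a)"
proof -
  have diff_swap: "p - q = r - s \<longleftrightarrow> p - r = q - s" for p q r s :: 'b
    by (auto simp: algebra_simps)
  have "(\<forall>j\<in>A. u (\<sigma> j) - u (\<sigma> a) = v (\<sigma> j) - v (\<sigma> a)) \<longleftrightarrow>
      (\<forall>j\<in>A. u (\<sigma> j) - v (\<sigma> j) = u (\<sigma> a) - v (\<sigma> a))"
    by (intro ball_cong refl diff_swap)
  also have "\<dots> \<longleftrightarrow> (\<forall>j\<in>\<sigma> ` A. u j - v j = u (\<sigma> a) - v (\<sigma> a))"
    by simp
  also have "\<dots> \<longleftrightarrow> (\<forall>j\<in>A. u j - v j = u (\<sigma> a) - v (\<sigma> a))"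
    using assms(1) by (simp add: permutes_image)
  also have "\<dots> \<longleftrightarrow> (\<forall>j\<in>A. u j - v j = u a - v a)"
    using assms permutes_in_image[OF assms(1), of a] by metis
  also have "\<dots> \<longleftrightarrow> (\<forall>j\<in>A. u j - u a = v j - v a)"
    by (intro ball_cong refl diff_swap)
  finally show ?thesis .
qed

theorem corollary6:
  fixes J p :: nat and X :: "real vec set"
  assumes "J \<ge> 3"
    and "p \<ge> 1"
    and "X \<subseteq> carrier_vec p"
    and "X \<noteq> {}"
  shows "\<forall>\<sigma>. \<sigma> permutes {1..J} \<longrightarrow>
    invariant_under J X (carrier_vec ((J - 1) * (1 + p)))
      (reference_ratio J) logistic_cdf (complete_design J p) \<sigma>"
proof (intro allI impI)
  fix \<sigma> assume \<sigma>: "\<sigma> permutes {1..J}"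
  let ?B = "carrier_vec ((J - 1) * (1 + p)) :: real vec set"
  let ?h = "permute_param J p \<sigma>"
  let ?rhs = "\<lambda>x \<beta>. map_vec logistic_cdf (complete_design J p x *\<^sub>v \<beta>)"
  have J: "1 \<le> J" "J \<in> {1..J}" using assms(1) by auto
  have h: "bij_betw ?h ?B ?B" using \<sigma> J(1) by (rule bij_betw_permute_param)
  have "model_prob J (reference_ratio J) logistic_cdf (complete_design J p) x \<beta>
      = permuted_model_prob J \<sigma> (reference_ratio J) logistic_cdf (complete_design J p) x (?h \<beta>)"
    if x: "x \<in> X" and \<beta>: "\<beta> \<in> ?B" for x \<beta>
  proof -
    have x': "x \<in> carrier_vec p" using x assms(3) by auto
    have h\<beta>: "?h \<beta> \<in> ?B" using h \<beta> by (rule bij_betwE[THEN bspec])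
    \<comment> \<open>Both models are \<open>THE\<close> descriptions over
      \<open>prob_vecs J\<close>, so they coincide once their defining equations are equivalent for
      every \<open>\<pi>\<close> in that set.\<close>
    have "reference_ratio J \<pi> = ?rhs x \<beta> \<longleftrightarrow>
        reference_ratio J (permute_probs J \<sigma> \<pi>) = ?rhs x (?h \<beta>)" if \<pi>: "\<pi> \<in> prob_vecs J" for \<pi>
    proof -
      have pos: "0 < cat_prob J (permute_probs J \<sigma> \<pi>) j" if "j \<in> {1..J}" for j
        using that \<sigma> \<pi> permutes_in_image[OF \<sigma>] by (metis cat_prob_permute_probs cat_prob_pos)
      let ?u = "\<lambda>j. ln (cat_prob J \<pi> j)" and ?v = "linear_predictor J p x \<beta>"
      have "reference_ratio J (permute_probs J \<sigma> \<pi>) = ?rhs x (?h \<beta>) \<longleftrightarrow>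
          (\<forall>j\<in>{1..J}. ?u (\<sigma> j) - ?u (\<sigma> J) = ?v (\<sigma> j) - ?v (\<sigma> J))"
        using J \<sigma>
        by (subst reference_ratio_eq_iff[OF pos J(1) x' h\<beta>])
          (auto simp: cat_prob_permute_probs linear_predictor_permute_param)
      also have "\<dots> \<longleftrightarrow> (\<forall>j\<in>{1..J}. ?u j - ?u J = ?v j - ?v J)"
        using \<sigma> J(2) by (rule permutes_differences_eq_iff)
      also have "\<dots> \<longleftrightarrow> reference_ratio J \<pi> = ?rhs x \<beta>"
        by (subst reference_ratio_eq_iff[OF cat_prob_pos[OF \<pi>] J(1) x' \<beta>]) auto
      finally show ?thesis by blast
    qed
    then show ?thesis
      unfolding model_prob_def permuted_model_prob_def by (metis (lifting))
  qed
  with h show "invariant_under J X ?B (reference_ratio J) logistic_cdf (complete_design J p) \<sigma>"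
    unfolding invariant_under_def equivalent_models_def by blast
qed

end
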